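(* Let $\lambda>0$ and consider the type II AWGN wiretap channel AWGN-WT($\lambda$) described in the context. Let $\{\mathcal{C}(n)\}$ be a good binary linear code sequence of rate $R_c$ with erasure rate threshold $\delta^{\star}$ for binary erasure channels. Let $\mathcal{C}_0(n)=\{0,1\}^n$ and $\mathcal{C}_1(n)=\mathcal{C}^{\perp}(n)$, the dual code of $\mathcal{C}(n)$. Suppose the secure nested code sequence $\{\mathcal{C}_0(n),\mathcal{C}_1(n)\}$ is used over AWGN-WT($\lambda$). If $$Q(\sqrt{2\lambda})\ge(1-\delta^{\star})/2,$$ where $Q(x)=\int_x^\infty\frac{1}{\sqrt{2\pi}}e^{-z^2/2}\,dz$, then the rate-equivocation pair $(R,R_e)=(R_c,R_c)$ is achievable (i.e., perfect secrecy at rate $R_c$).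
   Context: Type II AWGN wiretap channel AWGN-WT($\lambda$): the transmitter sends a binary sequence $\mathbf{x}\in\{0,1\}^n$ (symbols mapped to $\pm1$); the main channel to the legitimate receiver is noiseless; the eavesdropper channel is memoryless binary-input AWGN with output densities $g(z|X=1)=\frac{1}{\sqrt{2\pi}}\exp[-(z+\sqrt{2\lambda})^2/2]$ and $g(z|X=-1)=\frac{1}{\sqrt{2\pi}}\exp[-(z-\sqrt{2\lambda})^2/2]$. A binary linear code sequence $\{\mathcal{C}(n)\}$ consists of $(n,k_n)$ binary linear codes with common rate $R_c=k_n/n$; it is good if it achieves arbitrarily small word error probability over a noisy channel at nonzero rate. Its erasure rate threshold $\delta^\star$ is the worst-case (largest) erasure probability of a binary erasure channel at which the word error probability (under maximum-likelihood decoding) tends to zero as $n\to\infty$. The dual code is $\mathcal{C}^\perp(n)=\{\mathbf{x}\in\{0,1\}^n:\mathbf{x}\cdot\mathbf{y}=0\ \forall\mathbf{y}\in\mathcal{C}(n)\}$. Secure nested code sequence: $\mathcal{C}_1(n)\subseteq\mathcal{C}_0(n)$ linear codes of rates $R_1\le R_0$; cosets of $\mathcal{C}_1(n)$ in $\mathcal{C}_0(n)$ are indexed by messages $w\in\{1,\dots,M\}$, $M=2^{n(R_0-R_1)}$; a uniform message $W=w$ is encoded by choosing a codeword uniformly at random from the coset $\mathcal{C}_w(n)$; the legitimate receiver recovers $w$ as the coset of the received word. Information rate is $R_0-R_1$. A pair $(R,R_e)$ is achievable if there is a rate-$R$ code sequence with average error probability at the legitimate receiver tending to $0$ and $R_e\le\lim_{n\to\infty}H(W|\mathbf{Z})/n$,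 where $\mathbf{Z}$ is the eavesdropper's output. *)

theory Defs
  imports "HOL-Probability.Probability"
begin

definition bword :: "nat \<Rightarrow> (nat \<Rightarrow> bool) set" where
  "bword n = ({..<n} \<rightarrow>\<^sub>E (UNIV :: bool set))"

definition bxor :: "nat \<Rightarrow> (nat \<Rightarrow> bool) \<Rightarrow> (nat \<Rightarrow> bool) \<Rightarrow> (nat \<Rightarrow> bool)" where
  "bxor n x y = restrict (\<lambda>i. x i \<noteq> y i) {..<n}"

definition linear_code :: "nat \<Rightarrow> (nat \<Rightarrow> bool) set \<Rightarrow> bool" where
  "linear_code n C \<longleftrightarrow> C \<subseteq> bword n \<and> C \<noteq> {} \<and> (\<forall>x\<in>C. \<forall>y\<in>C. bxor n x y \<in> C)"

definition dual_code :: "nat \<Rightarrow> (nat \<Rightarrow> bool) set \<Rightarrow> (nat \<Rightarrow> bool) set" where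
  "dual_code n C = {x \<in> bword n. \<forall>y\<in>C. even (card {i\<in>{..<n}. x i \<and> y i})}"

definition bec_out :: "nat \<Rightarrow> (nat \<Rightarrow> bool option) set" where
  "bec_out n = ({..<n} \<rightarrow>\<^sub>E (UNIV :: bool option set))"

definition bec_trans :: "real \<Rightarrow> nat \<Rightarrow> (nat \<Rightarrow> bool) \<Rightarrow> (nat \<Rightarrow> bool option) \<Rightarrow> real" where
  "bec_trans \<delta> n x y = (\<Prod>i<n. (case y i of None \<Rightarrow> \<delta> | Some b \<Rightarrow> (if b = x i then 1 - \<delta> else 0)))"

text \<open>Word error probability of maximum-likelihood decoding (uniformly distributed codeword,
  any deterministic tie-breaking rule): 1 - (1/|C|) \<Sum>_y max_c P(y|c).\<close>
definition bec_ml_error :: "real \<Rightarrow> nat \<Rightarrow> (nat \<Rightarrow> bool) set \<Rightarrow> real" where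
  "bec_ml_error \<delta> n C =
     1 - (\<Sum>y\<in>bec_out n. Max ((\<lambda>c. bec_trans \<delta> n c y) ` C)) / real (card C)"

definition erasure_threshold :: "(nat \<Rightarrow> nat) \<Rightarrow> (nat \<Rightarrow> (nat \<Rightarrow> bool) set) \<Rightarrow> real" where
  "erasure_threshold len C =
     Sup {\<delta> \<in> {0..1}. (\<lambda>m. bec_ml_error \<delta> (len m) (C m)) \<longlonglongrightarrow> 0}"

text \<open>Good: nonzero rate and vanishing word error probability over a noisy channel
  (here: a BEC with nonzero erasure probability).\<close>
definition good_code_seq :: "(nat \<Rightarrow> nat) \<Rightarrow> (nat \<Rightarrow> (nat \<Rightarrow> bool) set) \<Rightarrow> real \<Rightarrow> bool" where
  "good_code_seq len C Rc \<longleftrightarrow> Rc > 0 \<and>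
     (\<exists>\<delta>\<in>{0<..<1}. (\<lambda>m. bec_ml_error \<delta> (len m) (C m)) \<longlonglongrightarrow> 0)"

text \<open>Messages are the cosets of C1 in C0.\<close>
definition nested_cosets :: "nat \<Rightarrow> (nat \<Rightarrow> bool) set \<Rightarrow> (nat \<Rightarrow> bool) set \<Rightarrow> (nat \<Rightarrow> bool) set set" where
  "nested_cosets n C0 C1 = (\<lambda>x. (\<lambda>c. bxor n x c) ` C1) ` C0"

text \<open>Legitimate receiver (noiseless main channel) decodes the coset containing the received word.
  Average error probability with uniform message and uniform codeword in the coset.\<close>
definition legit_error :: "nat \<Rightarrow> (nat \<Rightarrow> bool) set \<Rightarrow> (nat \<Rightarrow> bool) set \<Rightarrow> real" where
  "legit_error n C0 C1 =
     (let Ws = nested_cosets n C0 C1;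
          dec = (\<lambda>x. THE w. w \<in> Ws \<and> x \<in> w)
      in (\<Sum>w\<in>Ws. (1 / real (card Ws)) *
            (\<Sum>x\<in>w. (1 / real (card w)) * (if dec x = w then 0 else 1))))"

definition bpsk :: "bool \<Rightarrow> real" where
  "bpsk b = (if b then -1 else 1)"

definition awgn_g :: "real \<Rightarrow> real \<Rightarrow> real \<Rightarrow> real" where
  "awgn_g lam s z = exp (- ((z + s * sqrt (2 * lam))\<^sup>2) / 2) / sqrt (2 * pi)"

definition awgn_dens :: "real \<Rightarrow> nat \<Rightarrow> (nat \<Rightarrow> bool) \<Rightarrow> (nat \<Rightarrow> real) \<Rightarrow> real" where
  "awgn_dens lam n x z = (\<Prod>i<n. awgn_g lam (bpsk (x i)) (z i))"

definition msg_dens :: "real \<Rightarrow> nat \<Rightarrow> (nat \<Rightarrow> bool) set \<Rightarrow> (nat \<Rightarrow> real) \<Rightarrow> real" where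
  "msg_dens lam n w z = (\<Sum>x\<in>w. awgn_dens lam n x z) / real (card w)"

definition eve_equivocation :: "real \<Rightarrow> nat \<Rightarrow> (nat \<Rightarrow> bool) set set \<Rightarrow> real" where
  "eve_equivocation lam n Ws =
     (let pW = 1 / real (card Ws);
          fZ = (\<lambda>z. \<Sum>w\<in>Ws. pW * msg_dens lam n w z)
      in integral\<^sup>L (PiM {..<n} (\<lambda>_. lborel))
           (\<lambda>z. \<Sum>w\<in>Ws. pW * msg_dens lam n w z *
                  (- log 2 (pW * msg_dens lam n w z / fZ z))))"

definition Qfun :: "real \<Rightarrow> real" where
  "Qfun x = (LINT z:{x..}|lborel. exp (- (z\<^sup>2) / 2) / sqrt (2 * pi))"

end

theory Submission
  imports Defs
begin

text \<open>
  Let \<open>\<epsilon>\<close> be the integral of the pointwise minimum of the two output densities; a direct computation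
  gives \<open>\<epsilon> = 2 Q(sqrt (2 \<lambda>))\<close>. Splitting each density into this common part and the excess over it
  exhibits the eavesdropper's channel as a degraded binary erasure channel with erasure probability
  \<open>\<epsilon>\<close>: with probability \<open>1 - \<epsilon>\<close> a position lies in the random set \<open>S\<close> of revealed positions, and
  otherwise its output is independent of the input. By the log-sum inequality and a character-sum
  count, cosets of the dual code have equivocation at least \<open>log |C| - E log |C\<^sub>S|\<close>, where \<open>C\<^sub>S\<close> is the
  subcode of \<open>C\<close> supported on \<open>S\<close>. When \<open>C\<close> itself is sent over an erasure channel and \<open>S\<close> is the set
  of erasures, the error probability is at least \<open>E (1 - 1 / |C\<^sub>S|)\<close>, hence \<open>E log |C\<^sub>S| = o(n)\<close> at
  erasure rates with vanishing error. Adding a position to \<open>S\<close> increases \<open>log |C\<^sub>S|\<close> by at most one,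
  so \<open>E log |C\<^sub>S|\<close> is \<open>n\<close>-Lipschitz in the rate, which settles the boundary case
  \<open>1 - \<epsilon> = \<delta>\<^sup>*\<close>.
\<close>

subsection \<open>Binary words, linear codes and duality\<close>

definition zero_on :: "nat \<Rightarrow> nat set \<Rightarrow> (nat \<Rightarrow> bool) set" where
  "zero_on n S = {x \<in> bword n. \<forall>i\<in>S. \<not> x i}"

text \<open>In coding terms the code shortened at the positions outside \<open>S\<close>, but
  without deleting these positions, so that all subcodes live in the same
  \<open>bword n\<close>.\<close>

definition shortened :: "nat \<Rightarrow> (nat \<Rightarrow> bool) set \<Rightarrow> nat set \<Rightarrow> (nat \<Rightarrow> bool) set" where
  "shortened n C S = {y \<in> C. \<forall>i\<in>{..<n} - S. \<not> y i}"

text \<open>The character (-1)^(x . y) of the group of binary words. The product form lets sums over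
  coordinate subspaces factor over positions.\<close>

definition character :: "nat \<Rightarrow> (nat \<Rightarrow> bool) \<Rightarrow> (nat \<Rightarrow> bool) \<Rightarrow> real" where
  "character n x y = (\<Prod>i<n. if x i \<and> y i then -1 else 1)"

lemma finite_bword [simp]: "finite (bword n)"
  by (simp add: bword_def finite_PiE)

lemma card_bword: "card (bword n) = 2 ^ n"
  by (simp add: bword_def card_PiE)

lemma bword_eqI: "x \<in> bword n \<Longrightarrow> y \<in> bword n \<Longrightarrow> (\<And>i. i < n \<Longrightarrow> x i = y i) \<Longrightarrow> x = y"
  unfolding bword_def by (rule PiE_ext) auto

lemma bxor_in_bword [simp]: "bxor n x y \<in> bword n"
  by (auto simp: bxor_def bword_def)

lemma bxor_apply: "i < n \<Longrightarrow> bxor n x y i \<longleftrightarrow> x i \<noteq> y i"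
  by (simp add: bxor_def)

lemma bxor_cancel: "y \<in> bword n \<Longrightarrow> bxor n x (bxor n x y) = y"
  by (rule bword_eqI[of _ n]) (auto simp: bxor_apply)

lemma bxor_assoc: "bxor n (bxor n x y) z = bxor n x (bxor n y z)"
  by (rule bword_eqI[of _ n]) (auto simp: bxor_apply)

lemma inj_on_bxor: "A \<subseteq> bword n \<Longrightarrow> inj_on (bxor n x) A"
  by (rule inj_onI) (metis bxor_cancel subsetD)

text \<open>The third fact is membership of the zero word, which is \<open>bxor n u u\<close> for
  every \<open>u\<close>.\<close>

lemma linear_codeD:
  assumes "linear_code n C"
  shows "C \<subseteq> bword n" "x \<in> C \<Longrightarrow> y \<in> C \<Longrightarrow> bxor n x y \<in> C"
    "bxor n u u \<in> C" "finite C" "card C > 0"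
proof -
  show 1: "C \<subseteq> bword n" and 2: "x \<in> C \<Longrightarrow> y \<in> C \<Longrightarrow> bxor n x y \<in> C"
    using assms by (auto simp: linear_code_def)
  obtain v where "v \<in> C" using assms by (auto simp: linear_code_def)
  then have "bxor n v v \<in> C" using assms by (auto simp: linear_code_def)
  then show "bxor n u u \<in> C" by (simp add: bxor_def)
  show "finite C" using 1 finite_bword finite_subset by blast
  then show "card C > 0" using \<open>v \<in> C\<close> card_gt_0_iff by blast
qed

lemma bij_betw_bxor_code:
  assumes "linear_code n C" "y \<in> C"
  shows "bij_betw (bxor n y) C C"
proof -
  have "bxor n y ` C = C"
  proof
    show "bxor n y ` C \<subseteq> C" using assms linear_codeD(2) by blast
    show "C \<subseteq> bxor n y ` C"
    proof
      fix x assume "x \<in> C"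
      then have "x = bxor n y (bxor n y x)" "bxor n y x \<in> C"
        using assms linear_codeD by (auto simp: bxor_cancel subset_iff)
      then show "x \<in> bxor n y ` C" by blast
    qed
  qed
  then show ?thesis using assms linear_codeD(1) inj_on_bxor by (auto simp: bij_betw_def)
qed

section \<open>Character sums over a code and over a coordinate subspace\<close>

lemma character_power: "character n x y = (-1) ^ card {i\<in>{..<n}. x i \<and> y i}"
proof -
  have "character n x y = (\<Prod>i\<in>{i\<in>{..<n}. x i \<and> y i}. -1)"
    unfolding character_def by (rule prod.mono_neutral_cong_right) auto
  then show ?thesis by simp
qed

lemma character_bxor_left: "character n (bxor n x x') y = character n x y * character n x' y"
  unfolding character_def prod.distrib[symmetric] by (rule prod.cong) (auto simp: bxor_apply)

lemma character_bxor_right: "character n x (bxor n y y') = character n x y * character n x y'"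
  unfolding character_def prod.distrib[symmetric] by (rule prod.cong) (auto simp: bxor_apply)

lemma dual_code_character: "dual_code n C = {x \<in> bword n. \<forall>y\<in>C. character n x y = 1}"
  by (simp add: dual_code_def character_power minus_one_power_iff)

lemma linear_dual_code: "linear_code n (dual_code n C)"
proof -
  have "restrict (\<lambda>_. False) {..<n} \<in> dual_code n C"
    by (auto simp: dual_code_character bword_def character_def)
  then show ?thesis
    unfolding linear_code_def by (auto simp: dual_code_character character_bxor_left)
qed

text \<open>Orthogonality: if some \<open>y\<close> in \<open>C\<close> has character value -1 at
  \<open>x\<close>, translating \<open>C\<close> by \<open>y\<close> permutes the summands and flips
  the sign of the sum.\<close>

lemma sum_character_code:
  assumes "linear_code n C" "x \<in> bword n"
  shows "(\<Sum>y\<in>C. character n x y) = (if x \<in> dual_code n C then real (card C) else 0)"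
proof (cases "x \<in> dual_code n C")
  case True
  then show ?thesis by (simp add: dual_code_character)
next
  case False
  then obtain y where y: "y \<in> C" "character n x y \<noteq> 1"
    using assms by (auto simp: dual_code_character)
  then have m: "character n x y = -1" by (auto simp: character_power minus_one_power_iff split: if_splits)
  have "(\<Sum>v\<in>C. character n x v) = (\<Sum>v\<in>C. character n x (bxor n y v))"
    using sum.reindex_bij_betw[OF bij_betw_bxor_code[OF assms(1) y(1)]] by metis
  also have "\<dots> = - (\<Sum>v\<in>C. character n x v)"
    by (simp add: character_bxor_right m sum_negf)
  finally show ?thesis using False by simp
qed

lemma PiE_fixed_positions:
  "PiE {..<n} (\<lambda>i. if i \<in> S then {b i} else UNIV) = {x \<in> bword n. \<forall>i\<in>S \<inter> {..<n}. x i = b i}"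
proof -
  have *: "x i \<in> (if i \<in> S then {b i} else UNIV) \<longleftrightarrow> (i \<in> S \<longrightarrow> x i = b i)" for x i
    by simp
  show ?thesis
    by (rule set_eqI, simp only: bword_def PiE_iff mem_Collect_eq *) auto
qed

lemma card_fixed_positions:
  assumes "S \<subseteq> {..<n}"
  shows "card {x \<in> bword n. \<forall>i\<in>S. x i = b i} = 2 ^ card ({..<n} - S)"
proof -
  have "{x \<in> bword n. \<forall>i\<in>S. x i = b i} = PiE {..<n} (\<lambda>i. if i \<in> S then {b i} else UNIV)"
    unfolding PiE_fixed_positions using assms by (simp add: Int_absorb2)
  then have "card {x \<in> bword n. \<forall>i\<in>S. x i = b i}
      = (\<Prod>i<n. card (if i \<in> S then {b i} else UNIV))"
    by (simp only: card_PiE finite_lessThan)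
  also have "\<dots> = (\<Prod>i<n. if i \<in> {..<n} - S then 2 else 1)"
    by (rule prod.cong) auto
  also have "\<dots> = 2 ^ card ({..<n} - S)"
    by (subst prod.inter_restrict[symmetric]) (auto simp: Int_absorb1 Diff_subset)
  finally show ?thesis .
qed

text \<open>The sum factors over positions: a position of \<open>S\<close> contributes 1, any other
  one contributes 1 + (-1)^(y i), that is 2 or 0.\<close>

lemma sum_character_zero_on:
  assumes "S \<subseteq> {..<n}"
  shows "(\<Sum>x\<in>zero_on n S. character n x y)
    = (if \<forall>i\<in>{..<n} - S. \<not> y i then 2 ^ card ({..<n} - S) else 0)"
proof -
  have "S \<inter> {..<n} = S" using assms by blast
  then have Z: "zero_on n S = PiE {..<n} (\<lambda>i. if i \<in> S then {False} else UNIV)"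
    using PiE_fixed_positions[of n S "\<lambda>_. False"] by (auto simp: zero_on_def)
  have "(\<Sum>x\<in>zero_on n S. character n x y)
      = (\<Prod>i<n. \<Sum>b\<in>(if i \<in> S then {False} else UNIV). if b \<and> y i then -1 else 1)"
    unfolding Z character_def by (subst prod_sum_PiE) auto
  also have "\<dots> = (\<Prod>i<n. if i \<in> {..<n} - S then (if y i then 0 else 2) else 1)"
    by (rule prod.cong) (auto simp: UNIV_bool)
  also have "\<dots> = (\<Prod>i\<in>{..<n} - S. if y i then 0 else 2)"
    by (subst prod.inter_restrict[symmetric]) (auto simp: Int_absorb1 Diff_subset)
  also have "\<dots> = (if \<forall>i\<in>{..<n} - S. \<not> y i then 2 ^ card ({..<n} - S) else 0)"
    by auto
  finally show ?thesis .
qed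

text \<open>Double counting of the character sum over \<open>zero_on n S\<close> and
  \<open>C\<close>: summing over \<open>C\<close> first singles out dual words, summing over
  \<open>zero_on n S\<close> first singles out codewords supported on \<open>S\<close>.\<close>

lemma card_dual_zero_on:
  assumes "linear_code n C" "S \<subseteq> {..<n}"
  shows "card C * card (dual_code n C \<inter> zero_on n S) = 2 ^ card ({..<n} - S) * card (shortened n C S)"
proof -
  note fC = linear_codeD(4)[OF assms(1)]
  have fZ: "finite (zero_on n S)" by (simp add: zero_on_def)
  have "(\<Sum>x\<in>zero_on n S. \<Sum>y\<in>C. character n x y)
      = (\<Sum>x\<in>zero_on n S. if x \<in> dual_code n C then real (card C) else 0)"
    using sum_character_code[OF assms(1)] by (intro sum.cong) (auto simp: zero_on_def)
  also have "\<dots> = real (card C) * real (card (dual_code n C \<inter> zero_on n S))"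
    using fZ by (subst sum.inter_restrict[symmetric]) (auto simp: Int_commute)
  finally have 1: "(\<Sum>x\<in>zero_on n S. \<Sum>y\<in>C. character n x y)
      = real (card C) * real (card (dual_code n C \<inter> zero_on n S))" .
  have "(\<Sum>y\<in>C. \<Sum>x\<in>zero_on n S. character n x y)
      = (\<Sum>y\<in>C. if y \<in> shortened n C S then 2 ^ card ({..<n} - S) else 0)"
    by (rule sum.cong) (simp_all add: sum_character_zero_on[OF assms(2)] shortened_def)
  also have "\<dots> = 2 ^ card ({..<n} - S) * real (card (shortened n C S))"
    using fC by (subst sum.inter_restrict[symmetric]) (auto simp: Int_absorb1 shortened_def)
  finally have "real (card C) * real (card (dual_code n C \<inter> zero_on n S))
      = 2 ^ card ({..<n} - S) * real (card (shortened n C S))"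
    using 1 by (subst (asm) sum.swap) simp
  then have "real (card C * card (dual_code n C \<inter> zero_on n S))
      = real (2 ^ card ({..<n} - S) * card (shortened n C S))" by simp
  then show ?thesis using of_nat_eq_iff by blast
qed

lemma card_shortened_empty:
  assumes "linear_code n C"
  shows "card (shortened n C {}) = 1"
proof -
  have "restrict (\<lambda>_. False) {..<n} \<in> shortened n C {}"
    using linear_codeD(3)[OF assms, of undefined] by (simp add: bxor_def shortened_def)
  moreover have "y = restrict (\<lambda>_. False) {..<n}" if "y \<in> shortened n C {}" for y
  proof (rule bword_eqI)
    show "y \<in> bword n" using that linear_codeD(1)[OF assms] by (auto simp: shortened_def)
    show "restrict (\<lambda>_. False) {..<n} \<in> bword n" by (simp add: bword_def)
    show "y i = restrict (\<lambda>_. False) {..<n} i" if "i < n" for i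
      using that \<open>y \<in> shortened n C {}\<close> by (simp add: shortened_def)
  qed
  ultimately have "shortened n C {} = {restrict (\<lambda>_. False) {..<n}}" by blast
  then show ?thesis by simp
qed

lemma card_dual_code:
  assumes "linear_code n C"
  shows "card C * card (dual_code n C) = 2 ^ n"
proof -
  have "dual_code n C \<inter> zero_on n {} = dual_code n C"
    by (auto simp: zero_on_def dual_code_def)
  then show ?thesis
    using card_dual_zero_on[OF assms, of "{}"] card_shortened_empty[OF assms] by simp
qed

section \<open>Subcodes supported on a set of positions\<close>

lemma linear_shortened:
  assumes "linear_code n C"
  shows "linear_code n (shortened n C S)"
proof -
  have "bxor n undefined undefined \<in> shortened n C S"
    using linear_codeD(3)[OF assms] by (simp add: shortened_def bxor_apply)
  moreover have "bxor n x y \<in> shortened n C S" if "x \<in> shortened n C S" "y \<in> shortened n C S" for x y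
    using that linear_codeD(2)[OF assms] by (simp add: shortened_def bxor_apply)
  ultimately show ?thesis
    using linear_codeD(1)[OF assms] unfolding linear_code_def by (auto simp: shortened_def)
qed

lemma shortened_mono: "S \<subseteq> T \<Longrightarrow> shortened n C S \<subseteq> shortened n C T"
  by (auto simp: shortened_def)

text \<open>The smaller subcode is the kernel of the bit at \<open>i\<close>, so its index is 1 or
  2: any \<open>v\<close> outside it has \<open>v i\<close> set, and the kernel together with its
  translate by \<open>v\<close> covers everything.\<close>

lemma card_shortened_insert:
  assumes "linear_code n C"
  shows "card (shortened n C (insert i S)) \<le> 2 * card (shortened n C S)"
proof -
  let ?D = "shortened n C (insert i S)" and ?E = "shortened n C S"
  note L = linear_shortened[OF assms]
  have fE: "finite ?E" using linear_codeD(4)[OF L] .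
  show ?thesis
  proof (cases "?D \<subseteq> ?E")
    case True
    then have "card ?D \<le> card ?E" by (rule card_mono[OF fE])
    then show ?thesis by linarith
  next
    case False
    then obtain v where v: "v \<in> ?D" "v \<notin> ?E" by blast
    have iv: "i < n" "v i" using v by (auto simp: shortened_def)
    have "?D \<subseteq> ?E \<union> bxor n v ` ?E"
    proof
      fix x assume x: "x \<in> ?D"
      show "x \<in> ?E \<union> bxor n v ` ?E"
      proof (cases "x i")
        case True
        have "bxor n v x \<in> ?D" using linear_codeD(2)[OF L] v x by blast
        then have "bxor n v x \<in> ?E" using True iv by (auto simp: shortened_def bxor_apply)
        moreover have "x = bxor n v (bxor n v x)"
          using x linear_codeD(1)[OF L, of "insert i S"] by (simp add: bxor_cancel subset_iff)
        ultimately show ?thesis by blast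
      next
        case False
        then have "x \<in> ?E" using x by (auto simp: shortened_def)
        then show ?thesis by blast
      qed
    qed
    then have "card ?D \<le> card (?E \<union> bxor n v ` ?E)" using fE by (intro card_mono) auto
    also have "\<dots> \<le> card ?E + card ?E"
      using card_Un_le[of ?E "bxor n v ` ?E"] card_image_le[OF fE, of "bxor n v"] by linarith
    finally show ?thesis by simp
  qed
qed

subsection \<open>Random subsets\<close>

definition random_subset_weight :: "real \<Rightarrow> nat set \<Rightarrow> nat set \<Rightarrow> real" where
  "random_subset_weight p I S = (\<Prod>i\<in>I. if i \<in> S then p else 1 - p)"

text \<open>A finite sum instead of an expectation on a probability space, so that induction on
  \<open>I\<close> works directly; the recursion below holds for every real
  \<open>p\<close>.\<close>

definition random_subset_mean :: "real \<Rightarrow> nat set \<Rightarrow> (nat set \<Rightarrow> real) \<Rightarrow> real" where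
  "random_subset_mean p I F = (\<Sum>S\<in>Pow I. random_subset_weight p I S * F S)"

text \<open>Conditioning on whether the random subset contains \<open>i\<close>.\<close>

lemma random_subset_mean_insert:
  assumes "finite I" "i \<notin> I"
  shows "random_subset_mean p (insert i I) F
    = p * random_subset_mean p I (\<lambda>S. F (insert i S)) + (1 - p) * random_subset_mean p I F"
proof -
  have W1: "random_subset_weight p (insert i I) S = (1 - p) * random_subset_weight p I S"
    if "S \<in> Pow I" for S
    using that assms by (auto simp: random_subset_weight_def)
  have W2: "random_subset_weight p (insert i I) (insert i S) = p * random_subset_weight p I S"
    if "S \<in> Pow I" for S
    using that assms unfolding random_subset_weight_def by (simp, intro disjI2 prod.cong) auto
  have inj: "inj_on (insert i) (Pow I)" using assms by (auto intro!: inj_onI)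
  have "random_subset_mean p (insert i I) F
      = (\<Sum>S\<in>Pow I. random_subset_weight p (insert i I) S * F S)
        + (\<Sum>S\<in>insert i ` Pow I. random_subset_weight p (insert i I) S * F S)"
    unfolding random_subset_mean_def Pow_insert
    by (rule sum.union_disjoint) (use assms in auto)
  also have "\<dots> = (\<Sum>S\<in>Pow I. (1 - p) * random_subset_weight p I S * F S)
        + (\<Sum>S\<in>Pow I. p * random_subset_weight p I S * F (insert i S))"
    by (simp add: sum.reindex[OF inj] W1 W2)
  finally show ?thesis
    unfolding random_subset_mean_def by (simp add: sum_distrib_left mult.assoc)
qed

lemma random_subset_weight_nonneg: "0 \<le> p \<Longrightarrow> p \<le> 1 \<Longrightarrow> 0 \<le> random_subset_weight p I S"
  unfolding random_subset_weight_def by (rule prod_nonneg) auto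

lemma random_subset_mean_mono:
  assumes "0 \<le> p" "p \<le> 1" "\<And>S. S \<subseteq> I \<Longrightarrow> F S \<le> G S"
  shows "random_subset_mean p I F \<le> random_subset_mean p I G"
  unfolding random_subset_mean_def
  by (intro sum_mono mult_left_mono) (use assms random_subset_weight_nonneg in auto)

lemma random_subset_mean_const: "finite I \<Longrightarrow> random_subset_mean p I (\<lambda>_. c) = c"
proof (induction I rule: finite_induct)
  case empty
  then show ?case by (simp add: random_subset_mean_def random_subset_weight_def)
next
  case (insert i I)
  then show ?case by (simp add: random_subset_mean_insert algebra_simps)
qed

lemma random_subset_mean_diff:
  "random_subset_mean p I (\<lambda>S. F S - G S) = random_subset_mean p I F - random_subset_mean p I G"
  by (simp add: random_subset_mean_def sum_subtractf algebra_simps)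

lemma random_subset_mean_cmult:
  "random_subset_mean p I (\<lambda>S. c * F S) = c * random_subset_mean p I F"
  by (simp add: random_subset_mean_def sum_distrib_left algebra_simps)

text \<open>Elements are switched from rate \<open>p\<close> to rate \<open>q\<close> one at a time;
  each switch costs \<open>p - q\<close> times a mean increment of \<open>F\<close>, which lies in
  [0, 1]. The bound is one-sided: for \<open>p \<le> q\<close> the choice \<open>\<eta> = 0\<close>
  gives monotonicity.\<close>

lemma random_subset_mean_lipschitz:
  assumes "finite I" "0 \<le> p" "p \<le> 1" "0 \<le> q" "q \<le> 1" "p - q \<le> \<eta>" "0 \<le> \<eta>"
    and "\<And>i S. F S \<le> F (insert i S)" "\<And>i S. F (insert i S) \<le> F S + 1"
  shows "random_subset_mean p I F \<le> random_subset_mean q I F + real (card I) * \<eta>"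
  using assms(1,8,9)
proof (induction I arbitrary: F rule: finite_induct)
  case empty
  show ?case by (simp add: random_subset_mean_def random_subset_weight_def)
next
  case (insert i I)
  let ?G = "\<lambda>S. F (insert i S)"
  have 1: "random_subset_mean p I F \<le> random_subset_mean q I F + real (card I) * \<eta>"
    by (rule insert.IH) (fact insert.prems)+
  \<comment> \<open>The induction runs over all \<open>F\<close> because the hypothesis is needed
    for the shifted function \<open>?G\<close> too, whose increments are again increments of
    \<open>F\<close>.\<close>
  have 2: "random_subset_mean p I ?G \<le> random_subset_mean q I ?G + real (card I) * \<eta>"
  proof (rule insert.IH)
    fix j S
    show "?G S \<le> ?G (insert j S)" "?G (insert j S) \<le> ?G S + 1"
      using insert.prems(1)[of "insert i S" j] insert.prems(2)[of j "insert i S"]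
      by (simp_all only: insert_commute[of i j])
  qed
  \<comment> \<open>The mean gain from adding \<open>i\<close>, which is the slope of the recursion
    in the rate of \<open>i\<close>.\<close>
  define D where "D = random_subset_mean q I ?G - random_subset_mean q I F"
  have D0: "0 \<le> D"
    unfolding D_def using random_subset_mean_mono[OF assms(4,5) insert.prems(1)] by simp
  have D1: "D \<le> 1" unfolding D_def random_subset_mean_diff[symmetric]
    using random_subset_mean_mono[OF assms(4,5), of I "\<lambda>S. ?G S - F S" "\<lambda>_. 1"] insert.prems(2)
    by (simp add: random_subset_mean_const[OF insert.hyps(1)] diff_le_eq add.commute)
  have "(p - q) * D \<le> \<eta> * D" using assms(6) D0 by (rule mult_right_mono)
  also have "\<dots> \<le> \<eta>" using D1 assms(7) mult_left_le by blast
  finally have 3: "(p - q) * D \<le> \<eta>" .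
  have "random_subset_mean p (insert i I) F
      \<le> p * (random_subset_mean q I ?G + real (card I) * \<eta>)
        + (1 - p) * (random_subset_mean q I F + real (card I) * \<eta>)"
    unfolding random_subset_mean_insert[OF insert(1,2)]
    by (intro add_mono mult_left_mono 1 2) (use assms(2,3) in simp_all)
  also have "\<dots> = random_subset_mean q (insert i I) F + real (card I) * \<eta> + (p - q) * D"
    unfolding random_subset_mean_insert[OF insert(1,2)] D_def by (simp add: algebra_simps)
  finally show ?case using 3 insert(1,2) by (simp add: algebra_simps)
qed

subsection \<open>Cosets\<close>

text \<open>Any member of a coset may serve as its representative, since translating
  \<open>D\<close> by one of its own words gives \<open>D\<close> back.\<close>

lemma nested_cosets_eq:
  assumes D: "linear_code n D" and w: "w \<in> nested_cosets n (bword n) D" and x: "x \<in> w"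
  shows "w = bxor n x ` D"
proof -
  obtain u where u: "w = bxor n u ` D" using w by (auto simp: nested_cosets_def)
  then obtain c where c: "c \<in> D" "x = bxor n u c" using x by blast
  have "bxor n x ` D = bxor n u ` (bxor n c ` D)"
    unfolding c(2) image_image bxor_assoc ..
  also have "bxor n c ` D = D" using bij_betw_bxor_code[OF D c(1)] by (simp add: bij_betw_def)
  finally show ?thesis using u by simp
qed

lemma mem_own_coset:
  assumes "linear_code n D" "x \<in> bword n"
  shows "x \<in> bxor n x ` D"
proof -
  have "x = bxor n x (bxor n x x)" using assms by (simp add: bxor_cancel)
  then show ?thesis using linear_codeD(3)[OF assms(1), of x] by blast
qed

lemma nested_cosets_partition:
  assumes D: "linear_code n D"
  shows "\<Union>(nested_cosets n (bword n) D) = bword n"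
    and "finite (nested_cosets n (bword n) D)"
    and "w \<in> nested_cosets n (bword n) D \<Longrightarrow> finite w \<and> card w = card D"
    and "w \<in> nested_cosets n (bword n) D \<Longrightarrow> w' \<in> nested_cosets n (bword n) D \<Longrightarrow> w \<noteq> w'
      \<Longrightarrow> w \<inter> w' = {}"
proof -
  show "\<Union>(nested_cosets n (bword n) D) = bword n"
    using mem_own_coset[OF D] unfolding nested_cosets_def by auto
  show "finite (nested_cosets n (bword n) D)" by (simp add: nested_cosets_def)
  show "w \<in> nested_cosets n (bword n) D \<Longrightarrow> finite w \<and> card w = card D"
    using linear_codeD(1,4)[OF D] by (auto simp: nested_cosets_def card_image inj_on_bxor)
  show "w \<in> nested_cosets n (bword n) D \<Longrightarrow> w' \<in> nested_cosets n (bword n) D \<Longrightarrow> w \<noteq> w'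
      \<Longrightarrow> w \<inter> w' = {}"
    using nested_cosets_eq[OF D] by blast
qed

lemma sum_over_cosets:
  assumes "linear_code n D"
  shows "(\<Sum>w\<in>nested_cosets n (bword n) D. \<Sum>x\<in>w. f x) = (\<Sum>x\<in>bword n. f x)"
  using sum.Union_disjoint[of "nested_cosets n (bword n) D" f]
    nested_cosets_partition[OF assms] by (simp add: comp_def)

lemma card_nested_cosets:
  assumes "linear_code n D"
  shows "card (nested_cosets n (bword n) D) * card D = 2 ^ n"
proof -
  have "(\<Sum>w\<in>nested_cosets n (bword n) D. \<Sum>x\<in>w. 1::nat) = 2 ^ n"
    unfolding sum_over_cosets[OF assms] by (simp add: card_bword)
  then show ?thesis using nested_cosets_partition(3)[OF assms] by simp
qed

text \<open>Both cardinalities are \<open>2 ^ n\<close> divided by that of the dual code. Hence the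
  number of messages gives the information rate of \<open>C\<close> itself.\<close>

lemma card_nested_cosets_dual:
  assumes "linear_code n C"
  shows "card (nested_cosets n (bword n) (dual_code n C)) = card C"
proof -
  have "card (nested_cosets n (bword n) (dual_code n C)) * card (dual_code n C)
      = card C * card (dual_code n C)"
    using card_nested_cosets[OF linear_dual_code] card_dual_code[OF assms] by simp
  then show ?thesis using linear_codeD(5)[OF linear_dual_code, of n C] by simp
qed

text \<open>The main channel is noiseless and the cosets are disjoint, so the received word lies in
  exactly one of them.\<close>

lemma legit_error_eq_0:
  assumes D: "linear_code n D"
  shows "legit_error n (bword n) D = 0"
proof -
  let ?Ws = "nested_cosets n (bword n) D"
  have "(THE v. v \<in> ?Ws \<and> x \<in> v) = w" if "w \<in> ?Ws" "x \<in> w" for w x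
    by (rule the_equality) (use that nested_cosets_partition(4)[OF D] in blast)+
  then show ?thesis by (simp add: legit_error_def Let_def)
qed

text \<open>Two members of a coset that agree on \<open>S\<close> differ by a word of
  \<open>D\<close> vanishing on \<open>S\<close>. Only an inequality, because no member need match
  \<open>b\<close> on \<open>S\<close>.\<close>

lemma card_coset_agreeing:
  assumes D: "linear_code n D" and w: "w \<in> nested_cosets n (bword n) D" and S: "S \<subseteq> {..<n}"
  shows "card {x \<in> w. \<forall>i\<in>S. x i = b i} \<le> card (D \<inter> zero_on n S)"
proof (cases "{x \<in> w. \<forall>i\<in>S. x i = b i} = {}")
  case True
  show ?thesis unfolding True by simp
next
  case False
  then obtain u where u: "u \<in> w" "\<forall>i\<in>S. u i = b i" by blast
  have "{x \<in> w. \<forall>i\<in>S. x i = b i} \<subseteq> bxor n u ` (D \<inter> zero_on n S)"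
  proof
    fix x assume x: "x \<in> {x \<in> w. \<forall>i\<in>S. x i = b i}"
    then obtain c where c: "c \<in> D" "x = bxor n u c"
      using nested_cosets_eq[OF D w u(1)] by blast
    have "\<not> c i" if "i \<in> S" for i
    proof -
      have "i < n" using that S by blast
      then show ?thesis using x u that bxor_apply[of i n u c] c(2) by auto
    qed
    then have "c \<in> zero_on n S" using c linear_codeD(1)[OF D] by (auto simp: zero_on_def)
    then show "x \<in> bxor n u ` (D \<inter> zero_on n S)" using c by blast
  qed
  moreover have "finite (D \<inter> zero_on n S)" using linear_codeD(4)[OF D] by blast
  ultimately show ?thesis using surj_card_le by blast
qed

subsection \<open>The binary erasure channel\<close>

definition erased :: "nat \<Rightarrow> (nat \<Rightarrow> bool option) \<Rightarrow> nat set" where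
  "erased n y = {i \<in> {..<n}. y i = None}"

definition erase :: "nat \<Rightarrow> (nat \<Rightarrow> bool) \<Rightarrow> nat set \<Rightarrow> nat \<Rightarrow> bool option" where
  "erase n c S = restrict (\<lambda>i. if i \<in> S then None else Some (c i)) {..<n}"

text \<open>For an output consistent with \<open>c\<close> the probability depends on the erasure
  pattern alone; a single contradicted position makes it zero.\<close>

lemma bec_trans_eq:
  "bec_trans \<delta> n c y = (if \<forall>i<n. y i \<noteq> None \<longrightarrow> y i = Some (c i)
    then random_subset_weight \<delta> {..<n} (erased n y) else 0)"
proof (cases "\<forall>i<n. y i \<noteq> None \<longrightarrow> y i = Some (c i)")
  case True
  then have "bec_trans \<delta> n c y = random_subset_weight \<delta> {..<n} (erased n y)"
    unfolding bec_trans_def random_subset_weight_def erased_def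
    by (intro prod.cong) (auto split: option.splits)
  then show ?thesis using True by simp
next
  case False
  then obtain i b where i: "i < n" "y i = Some b" "b \<noteq> c i" by auto
  then have "bec_trans \<delta> n c y = 0"
    unfolding bec_trans_def by (intro prod_zero) (auto intro!: bexI[of _ i])
  then show ?thesis unfolding if_not_P[OF False] .
qed

text \<open>Once \<open>c\<close> is fixed, the outputs consistent with it correspond to their
  erasure sets. The law of the erasure set is therefore the same for all inputs.\<close>

lemma sum_bec_trans:
  "(\<Sum>y\<in>bec_out n. bec_trans \<delta> n c y * G (erased n y)) = random_subset_mean \<delta> {..<n} G"
proof -
  have er: "erased n (erase n c S) = S" if "S \<in> Pow {..<n}" for S
    using that by (auto simp: erased_def erase_def split: if_splits)
  have inj: "inj_on (erase n c) (Pow {..<n})" by (rule inj_on_inverseI[where g = "erased n"]) (rule er)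
  have "(\<Sum>y\<in>bec_out n. bec_trans \<delta> n c y * G (erased n y))
      = (\<Sum>y\<in>erase n c ` Pow {..<n}. bec_trans \<delta> n c y * G (erased n y))"
  proof (rule sum.mono_neutral_right)
    show "finite (bec_out n)" by (simp add: bec_out_def finite_PiE)
    show "erase n c ` Pow {..<n} \<subseteq> bec_out n" 
      unfolding bec_out_def erase_def by (intro image_subsetI restrict_PiE_iff[THEN iffD2]) simp
    show "\<forall>y\<in>bec_out n - erase n c ` Pow {..<n}. bec_trans \<delta> n c y * G (erased n y) = 0"
    proof
      fix y assume y: "y \<in> bec_out n - erase n c ` Pow {..<n}"
      have "\<not> (\<forall>i<n. y i \<noteq> None \<longrightarrow> y i = Some (c i))"
      proof
        assume a: "\<forall>i<n. y i \<noteq> None \<longrightarrow> y i = Some (c i)"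
        have "y = erase n c (erased n y)"
        proof (rule PiE_ext)
          show "y \<in> {..<n} \<rightarrow>\<^sub>E UNIV" using y by (simp add: bec_out_def)
          show "erase n c (erased n y) \<in> {..<n} \<rightarrow>\<^sub>E UNIV" by (simp add: erase_def)
          show "y i = erase n c (erased n y) i" if "i \<in> {..<n}" for i
            using a that by (auto simp: erase_def erased_def)
        qed
        moreover have "erased n y \<in> Pow {..<n}" by (auto simp: erased_def)
        ultimately show False using y by blast
      qed
      then have "bec_trans \<delta> n c y = 0" unfolding bec_trans_eq by (rule if_not_P)
      then show "bec_trans \<delta> n c y * G (erased n y) = 0" by simp
    qed
  qed
  also have "\<dots> = (\<Sum>S\<in>Pow {..<n}. bec_trans \<delta> n c (erase n c S) * G (erased n (erase n c S)))"
    by (simp add: sum.reindex[OF inj])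
  also have "\<dots> = random_subset_mean \<delta> {..<n} G"
    unfolding random_subset_mean_def
  proof (rule sum.cong)
    fix S assume S: "S \<in> Pow {..<n}"
    have "\<forall>i<n. erase n c S i \<noteq> None \<longrightarrow> erase n c S i = Some (c i)" by (simp add: erase_def)
    then show "bec_trans \<delta> n c (erase n c S) * G (erased n (erase n c S))
        = random_subset_weight \<delta> {..<n} S * G S"
      unfolding bec_trans_eq er[OF S] by (simp only: if_P)
  qed simp
  finally show ?thesis .
qed

section \<open>Decoding error and the subcode supported on the erasures\<close>

lemma bec_trans_nonneg: "0 \<le> \<delta> \<Longrightarrow> \<delta> \<le> 1 \<Longrightarrow> 0 \<le> bec_trans \<delta> n c y"
  unfolding bec_trans_eq by (rule if_split[THEN iffD2]) (simp add: random_subset_weight_nonneg)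

text \<open>The codewords that explain \<open>y\<close> as well as \<open>c\<close> form a coset of the subcode supported on the
  erasures.\<close>

lemma Max_bec_trans_le:
  assumes C: "linear_code n C" and d: "0 \<le> \<delta>" "\<delta> \<le> 1"
  shows "Max ((\<lambda>c. bec_trans \<delta> n c y) ` C)
    \<le> (\<Sum>c\<in>C. bec_trans \<delta> n c y) / card (shortened n C (erased n y))"
proof -
  let ?E = "shortened n C (erased n y)"
  have fC: "finite C" and neC: "C \<noteq> {}" using linear_codeD(4,5)[OF C] by auto
  have pos: "card ?E > 0" using linear_codeD(5)[OF linear_shortened[OF C]] .
  have "bec_trans \<delta> n c y \<le> (\<Sum>c\<in>C. bec_trans \<delta> n c y) / card ?E" if c: "c \<in> C" for c
  proof (cases "\<forall>i<n. y i \<noteq> None \<longrightarrow> y i = Some (c i)")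
    case False
    then have "bec_trans \<delta> n c y = 0" unfolding bec_trans_eq by (rule if_not_P)
    then show ?thesis using d by (simp add: sum_nonneg bec_trans_nonneg)
  next
    case True
    have sub: "bxor n c ` ?E \<subseteq> C" using linear_codeD(2)[OF C c] by (auto simp: shortened_def)
    have "inj_on (bxor n c) ?E"
      using inj_on_bxor linear_codeD(1)[OF linear_shortened[OF C]] by blast
    then have card: "card (bxor n c ` ?E) = card ?E" by (rule card_image)
    have same: "bec_trans \<delta> n v y = bec_trans \<delta> n c y" if v: "v \<in> bxor n c ` ?E" for v
    proof -
      obtain u where u: "u \<in> ?E" "v = bxor n c u" using v by blast
      have "v i = c i" if "i < n" "y i \<noteq> None" for i
        using that u by (auto simp: shortened_def erased_def bxor_apply)
      then have "\<forall>i<n. y i \<noteq> None \<longrightarrow> y i = Some (v i)" using True by simp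
      then show ?thesis using True unfolding bec_trans_eq by simp
    qed
    have "bec_trans \<delta> n c y * card ?E = (\<Sum>v\<in>bxor n c ` ?E. bec_trans \<delta> n v y)"
      using same card by simp
    also have "\<dots> \<le> (\<Sum>v\<in>C. bec_trans \<delta> n v y)"
      by (rule sum_mono2[OF fC sub]) (rule bec_trans_nonneg[OF d])
    finally show ?thesis using pos by (simp add: field_simps)
  qed
  then show ?thesis using fC neC by simp
qed

text \<open>Given the erasure set \<open>S\<close>, a decoder picks the right word among
  \<open>card (shortened n C S)\<close> equally likely ones, so it succeeds with at most the
  reciprocal probability.\<close>

lemma bec_ml_error_ge:
  assumes C: "linear_code n C" and d: "0 \<le> \<delta>" "\<delta> \<le> 1"
  shows "random_subset_mean \<delta> {..<n} (\<lambda>S. 1 - 1 / card (shortened n C S)) \<le> bec_ml_error \<delta> n C"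
proof -
  let ?G = "\<lambda>S. 1 / real (card (shortened n C S))"
  have pos: "card C > 0" using linear_codeD(5)[OF C] .
  have "(\<Sum>y\<in>bec_out n. Max ((\<lambda>c. bec_trans \<delta> n c y) ` C))
      \<le> (\<Sum>y\<in>bec_out n. \<Sum>c\<in>C. bec_trans \<delta> n c y * ?G (erased n y))"
    using Max_bec_trans_le[OF C d] by (intro sum_mono) (simp add: sum_divide_distrib)
  also have "\<dots> = (\<Sum>c\<in>C. random_subset_mean \<delta> {..<n} ?G)"
    by (subst sum.swap) (simp only: sum_bec_trans[where G = ?G])
  also have "\<dots> = card C * random_subset_mean \<delta> {..<n} ?G" by simp
  finally have "(\<Sum>y\<in>bec_out n. Max ((\<lambda>c. bec_trans \<delta> n c y) ` C)) / card C
      \<le> random_subset_mean \<delta> {..<n} ?G"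
    using pos by (simp add: field_simps)
  then show ?thesis
    unfolding bec_ml_error_def random_subset_mean_diff by (simp add: random_subset_mean_const)
qed

text \<open>For a trivial subcode both sides vanish. Otherwise it has at least 2 words, so the
  bracket is at least 1/2, which is why the factor 2 suffices against the trivial bound
  \<open>n\<close>.\<close>

lemma log_card_shortened_le:
  assumes C: "linear_code n C"
  shows "log 2 (card (shortened n C S)) \<le> 2 * real n * (1 - 1 / card (shortened n C S))"
proof -
  let ?k = "card (shortened n C S)"
  note L = linear_shortened[OF C, of S]
  have "?k \<le> 2 ^ n" using card_mono[OF finite_bword linear_codeD(1)[OF L]] by (simp add: card_bword)
  then have k: "real ?k \<le> 2 ^ n" by (metis of_nat_le_iff of_nat_numeral of_nat_power)
  have pos: "?k > 0" using linear_codeD(5)[OF L] .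
  show ?thesis
  proof (cases "?k = 1")
    case True
    then show ?thesis by simp
  next
    case False
    then have k2: "real ?k \<ge> 2" using pos by linarith
    have "log 2 ?k \<le> log 2 (2 ^ n)" using k pos by (intro log_mono) auto
    also have "\<dots> = 2 * real n * (1 / 2)" by (simp add: log_nat_power)
    also have "\<dots> \<le> 2 * real n * (1 - 1 / ?k)"
      using k2 by (intro mult_left_mono) (auto simp: field_simps)
    finally show ?thesis .
  qed
qed

lemma mean_log_card_shortened_le:
  assumes C: "linear_code n C" and d: "0 \<le> \<delta>" "\<delta> \<le> 1"
  shows "random_subset_mean \<delta> {..<n} (\<lambda>S. log 2 (card (shortened n C S)))
    \<le> 2 * real n * bec_ml_error \<delta> n C"
proof -
  have "random_subset_mean \<delta> {..<n} (\<lambda>S. log 2 (card (shortened n C S)))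
      \<le> 2 * real n * random_subset_mean \<delta> {..<n} (\<lambda>S. 1 - 1 / card (shortened n C S))"
    unfolding random_subset_mean_cmult[symmetric]
    by (rule random_subset_mean_mono[OF d log_card_shortened_le[OF C]])
  also have "\<dots> \<le> 2 * real n * bec_ml_error \<delta> n C"
    by (rule mult_left_mono[OF bec_ml_error_ge[OF C d]]) simp
  finally show ?thesis .
qed

text \<open>Adding a position enlarges the subcode by a factor between 1 and 2, hence its binary
  logarithm by an amount in [0, 1].\<close>

lemma mean_log_card_shortened_lipschitz:
  assumes C: "linear_code n C"
    and "0 \<le> p" "p \<le> 1" "0 \<le> q" "q \<le> 1" "p - q \<le> \<eta>" "0 \<le> \<eta>"
  shows "random_subset_mean p {..<n} (\<lambda>S. log 2 (card (shortened n C S)))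
    \<le> random_subset_mean q {..<n} (\<lambda>S. log 2 (card (shortened n C S))) + real n * \<eta>"
proof -
  have pos: "card (shortened n C S) > 0" for S using linear_codeD(5)[OF linear_shortened[OF C]] .
  have "log 2 (card (shortened n C S)) \<le> log 2 (card (shortened n C (insert i S)))" for i S
    using pos[of S] card_mono[OF linear_codeD(4)[OF linear_shortened[OF C]]
        shortened_mono[OF subset_insertI[of S i]]]
    by simp
  moreover have "log 2 (card (shortened n C (insert i S))) \<le> log 2 (card (shortened n C S)) + 1" for i S
  proof -
    have "real (card (shortened n C (insert i S))) \<le> 2 * real (card (shortened n C S))"
      using card_shortened_insert[OF C, of i S] by linarith
    then have "log 2 (card (shortened n C (insert i S))) \<le> log 2 (2 * real (card (shortened n C S)))"
      using pos[of "insert i S"] pos[of S] by simp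
    then show ?thesis using pos[of S] by (simp add: log_mult)
  qed
  ultimately show ?thesis
    using random_subset_mean_lipschitz[OF finite_lessThan[of n] assms(2-7)] by simp
qed

subsection \<open>Entropy inequalities\<close>

text \<open>Read \<open>a w s\<close> as the weight of message \<open>w\<close> jointly with side
  information \<open>s\<close>. The bound on \<open>a w s * M s\<close> says that no message has
  conditional probability above \<open>1 / M s\<close> given \<open>s\<close>, so the entropy given
  \<open>s\<close> is at least \<open>log 2 (M s)\<close>; forgetting \<open>s\<close> can only
  increase entropy. Weights are not normalised, so that the lemma applies at a fixed channel
  output.\<close>

lemma log_sum_lower:
  fixes a :: "'w \<Rightarrow> 's \<Rightarrow> real" and M :: "'s \<Rightarrow> real"
  assumes fin: "finite W" "finite T" and pos: "\<And>w. w \<in> W \<Longrightarrow> f w > 0"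
    and nonneg: "\<And>w s. w \<in> W \<Longrightarrow> s \<in> T \<Longrightarrow> a w s \<ge> 0"
    and f: "\<And>w. w \<in> W \<Longrightarrow> f w = (\<Sum>s\<in>T. a w s)"
    and A: "\<And>s. s \<in> T \<Longrightarrow> A s = (\<Sum>w\<in>W. a w s)"
    and M: "\<And>s. s \<in> T \<Longrightarrow> M s > 0" "\<And>w s. w \<in> W \<Longrightarrow> s \<in> T \<Longrightarrow> a w s * M s \<le> A s"
  shows "(\<Sum>s\<in>T. A s * log 2 (M s)) \<le> (\<Sum>w\<in>W. f w * (- log 2 (f w / (\<Sum>v\<in>W. f v))))"
proof -
  define F where "F = (\<Sum>v\<in>W. f v)"
  have FA: "F = (\<Sum>s\<in>T. A s)"
    unfolding F_def by (simp add: f A sum.swap[of _ T W])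
  have key: "(\<Sum>s\<in>T. a w s * ln (M s)) \<le> f w * (- ln (f w / F))" if w: "w \<in> W" for w
  proof -
    have Fp: "F > 0" unfolding F_def using w fin pos by (intro sum_pos) auto
    let ?r = "f w / F"
    have r: "?r > 0" using Fp pos[OF w] by simp
    \<comment> \<open>This is \<open>ln x \<le> x - 1\<close> at \<open>x = M s * ?r\<close>; after
      summation over \<open>s\<close> the right side becomes \<open>F * ?r - f w\<close>, which is
      zero.\<close>
    have "a w s * ln (M s) + a w s * ln ?r \<le> A s * ?r - a w s" if s: "s \<in> T" for s
    proof -
      have "ln (M s * ?r) \<le> M s * ?r - 1" using mult_pos_pos[OF M(1)[OF s] r] by (rule ln_le_minus_one)
      then have "a w s * ln (M s * ?r) \<le> a w s * (M s * ?r - 1)"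
        using nonneg[OF w s] by (rule mult_left_mono)
      also have "\<dots> = (a w s * M s) * ?r - a w s" by (simp add: algebra_simps)
      also have "\<dots> \<le> A s * ?r - a w s"
        using mult_right_mono[OF M(2)[OF w s], of ?r] r by simp
      finally show ?thesis
        unfolding ln_mult_pos[OF M(1)[OF s] r] by (simp only: distrib_left)
    qed
    then have "(\<Sum>s\<in>T. a w s * ln (M s) + a w s * ln ?r) \<le> (\<Sum>s\<in>T. A s * ?r - a w s)"
      by (rule sum_mono)
    also have "\<dots> = F * ?r - f w"
      unfolding sum_subtractf by (simp only: FA f[OF w] sum_distrib_right)
    also have "\<dots> = 0" using Fp by simp
    finally have "(\<Sum>s\<in>T. a w s * ln (M s)) + f w * ln ?r \<le> 0"
      by (simp add: f[OF w] sum.distrib sum_distrib_right)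
    then show ?thesis by simp
  qed
  have "(\<Sum>s\<in>T. A s * ln (M s)) = (\<Sum>w\<in>W. \<Sum>s\<in>T. a w s * ln (M s))"
    by (subst sum.swap) (simp add: A sum_distrib_right)
  also have "\<dots> \<le> (\<Sum>w\<in>W. f w * (- ln (f w / F)))" by (rule sum_mono[OF key])
  finally have "(\<Sum>s\<in>T. A s * ln (M s)) / ln 2 \<le> (\<Sum>w\<in>W. f w * (- ln (f w / F))) / ln 2"
    by (rule divide_right_mono) simp
  then show ?thesis unfolding F_def[symmetric] by (simp add: log_def sum_divide_distrib)
qed

text \<open>The uniform law maximises entropy, for unnormalised weights; it follows from
  \<open>ln x \<le> x - 1\<close> at the ratio of the average weight to \<open>f w\<close>.\<close>

lemma entropy_sum_upper:
  fixes f :: "'w \<Rightarrow> real"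
  assumes fin: "finite W" and pos: "\<And>w. w \<in> W \<Longrightarrow> f w > 0"
  shows "(\<Sum>w\<in>W. f w * (- log 2 (f w / (\<Sum>v\<in>W. f v)))) \<le> (\<Sum>v\<in>W. f v) * log 2 (card W)"
proof (cases "W = {}")
  case True
  then show ?thesis by simp
next
  case False
  define F where "F = (\<Sum>v\<in>W. f v)"
  have Fp: "F > 0" unfolding F_def using False fin pos by (intro sum_pos) auto
  have cW: "real (card W) > 0" using False fin by (simp add: card_gt_0_iff)
  have "f w * (- ln (f w / F)) \<le> F / card W - f w + f w * ln (card W)" if w: "w \<in> W" for w
  proof -
    have q: "F / (f w * card W) > 0" using Fp pos[OF w] cW by simp
    have "ln (F / (f w * card W)) = - ln (f w / F) - ln (card W)"
      using Fp pos[OF w] cW by (simp add: ln_div ln_mult)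
    moreover have "f w * ln (F / (f w * card W)) \<le> f w * (F / (f w * card W) - 1)"
      using ln_le_minus_one[OF q] pos[OF w] by (intro mult_left_mono) auto
    moreover have "f w * (F / (f w * card W) - 1) = F / card W - f w"
      using pos[OF w] cW by (simp add: field_simps)
    ultimately show ?thesis by (metis diff_le_eq right_diff_distrib)
  qed
  then have "(\<Sum>w\<in>W. f w * (- ln (f w / F))) \<le> (\<Sum>w\<in>W. F / card W - f w + f w * ln (card W))"
    by (rule sum_mono)
  also have "\<dots> = F * ln (card W)"
    using cW by (simp add: sum.distrib sum_subtractf F_def sum_distrib_right)
  finally have "(\<Sum>w\<in>W. f w * (- ln (f w / F))) / ln 2 \<le> F * ln (card W) / ln 2"
    by (rule divide_right_mono) simp
  then show ?thesis unfolding F_def[symmetric] by (simp add: log_def sum_divide_distrib)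
qed

subsection \<open>The Gaussian eavesdropper channel\<close>

definition awgn_common :: "real \<Rightarrow> real \<Rightarrow> real" where
  "awgn_common lam z = min (awgn_g lam (bpsk False) z) (awgn_g lam (bpsk True) z)"

definition awgn_excess :: "real \<Rightarrow> bool \<Rightarrow> real \<Rightarrow> real" where
  "awgn_excess lam b z = awgn_g lam (bpsk b) z - awgn_common lam z"

text \<open>Joint density of output \<open>z\<close> and revealed set \<open>S\<close> given the
  input \<open>x\<close>: excess densities at revealed positions, the common part elsewhere.\<close>

definition degraded_dens :: "real \<Rightarrow> nat \<Rightarrow> nat set \<Rightarrow> (nat \<Rightarrow> bool) \<Rightarrow> (nat \<Rightarrow> real) \<Rightarrow> real" where
  "degraded_dens lam n S x z =
     (\<Prod>i<n. if i \<in> S then awgn_excess lam (x i) (z i) else awgn_common lam (z i))"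

text \<open>The same joint density for a uniformly distributed input word, as
  \<open>sum_degraded_dens\<close> confirms.\<close>

definition degraded_out_dens :: "real \<Rightarrow> nat \<Rightarrow> nat set \<Rightarrow> (nat \<Rightarrow> real) \<Rightarrow> real" where
  "degraded_out_dens lam n S z =
     (\<Prod>i<n. if i \<in> S then (awgn_excess lam False (z i) + awgn_excess lam True (z i)) / 2
       else awgn_common lam (z i))"

lemma awgn_g_eq_normal_density: "awgn_g lam s = normal_density (- (s * sqrt (2 * lam))) 1"
  by (rule ext) (simp add: awgn_g_def normal_density_def)

lemma awgn_g_pos: "awgn_g lam s z > 0"
  by (simp add: awgn_g_def)

lemma measurable_awgn_g [measurable]: "awgn_g lam s \<in> borel_measurable borel"
  unfolding awgn_g_def[abs_def] by measurable

lemma integrable_awgn_g: "integrable lborel (awgn_g lam s)"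
  by (simp add: awgn_g_eq_normal_density)

lemma integral_awgn_g: "(\<integral>z. awgn_g lam s z \<partial>lborel) = 1"
  by (simp add: awgn_g_eq_normal_density)

lemma integrable_awgn_common: "integrable lborel (awgn_common lam)"
  unfolding awgn_common_def[abs_def] by (intro integrable_min integrable_awgn_g)

lemma awgn_common_nonneg: "awgn_common lam z \<ge> 0"
  by (simp add: awgn_common_def awgn_g_pos less_imp_le)

lemma awgn_excess_nonneg: "awgn_excess lam b z \<ge> 0"
  by (cases b) (auto simp: awgn_excess_def awgn_common_def)

text \<open>Only the strictly likelier bit has positive excess. At a tie both excesses vanish, so
  assigning ties to \<open>False\<close> is harmless.\<close>

lemma awgn_excess_eq_0:
  "b \<noteq> (awgn_g lam (bpsk False) z < awgn_g lam (bpsk True) z) \<Longrightarrow> awgn_excess lam b z = 0"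
  by (cases b) (auto simp: awgn_excess_def awgn_common_def)

text \<open>The smaller of the two densities belongs to the mean farther from \<open>z\<close>, and
  reflection at 0 exchanges the two densities.\<close>

lemma awgn_common_eq:
  assumes "lam > 0"
  shows "awgn_common lam z = awgn_g lam 1 \<bar>z\<bar>"
proof -
  let ?s = "sqrt (2 * lam)"
  have s: "?s > 0" using assms by simp
  have mono: "awgn_g lam a z \<le> awgn_g lam b z" if "(z + b * ?s)\<^sup>2 \<le> (z + a * ?s)\<^sup>2" for a b
    using that unfolding awgn_g_def by (intro divide_right_mono) auto
  have diff: "(z + ?s)\<^sup>2 - (z - ?s)\<^sup>2 = 4 * z * ?s" by (simp add: power2_eq_square algebra_simps)
  show ?thesis
  proof (cases "z \<ge> 0")
    case True
    then have "4 * z * ?s \<ge> 0" using s by simp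
    then have "awgn_g lam 1 z \<le> awgn_g lam (-1) z" using diff by (intro mono) simp
    then show ?thesis using True by (simp add: awgn_common_def bpsk_def)
  next
    case False
    then have "4 * z * ?s \<le> 0" using s by (simp add: mult_nonpos_nonneg)
    then have "awgn_g lam (-1) z \<le> awgn_g lam 1 z" using diff by (intro mono) simp
    moreover have "awgn_g lam (-1) z = awgn_g lam 1 (- z)"
      by (simp add: awgn_g_def power2_eq_square algebra_simps)
    ultimately show ?thesis using False by (simp add: awgn_common_def bpsk_def)
  qed
qed

text \<open>On each half-line the common part is the tail of the Gaussian centred on the other side;
  shifting by \<open>sqrt (2 * lam)\<close> turns each tail into \<open>Qfun\<close>.\<close>

lemma integral_awgn_common:
  assumes "lam > 0"
  shows "(\<integral>z. awgn_common lam z \<partial>lborel) = 2 * Qfun (sqrt (2 * lam))"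
proof -
  let ?s = "sqrt (2 * lam)"
  define h where "h z = indicator {0..} z * awgn_g lam 1 z" for z :: real
  have hI: "integrable lborel h"
    unfolding h_def using integrable_real_mult_indicator[OF _ integrable_awgn_g, of "{0..}"]
    by (simp add: mult.commute)
  have hI': "integrable lborel (\<lambda>z. h (- z))"
    using lborel_integrable_real_affine[OF hI, of "-1" 0] by simp
  have "Qfun ?s = (\<integral>z. indicator {?s..} z * (exp (- (z\<^sup>2) / 2) / sqrt (2 * pi)) \<partial>lborel)"
    by (simp add: Qfun_def set_lebesgue_integral_def)
  also have "\<dots> = (\<integral>z. indicator {?s..} (?s + z) * (exp (- ((?s + z)\<^sup>2) / 2) / sqrt (2 * pi)) \<partial>lborel)"
    using lborel_integral_real_affine[of 1 "\<lambda>z. indicator {?s..} z * (exp (- (z\<^sup>2) / 2) / sqrt (2 * pi))" ?s]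
    by simp
  also have "\<dots> = (\<integral>z. h z \<partial>lborel)"
    by (rule Bochner_Integration.integral_cong)
      (auto simp: h_def awgn_g_def indicator_def add.commute)
  finally have Q: "(\<integral>z. h z \<partial>lborel) = Qfun ?s" by simp
  have Q': "(\<integral>z. h (- z) \<partial>lborel) = Qfun ?s"
    using lborel_integral_real_affine[of "-1" h 0] Q by simp
  \<comment> \<open>At \<open>z = 0\<close> both halves count, so the integrands agree only almost
    everywhere.\<close>
  have "(\<integral>z. awgn_common lam z \<partial>lborel) = (\<integral>z. h z + h (- z) \<partial>lborel)"
  proof (rule integral_cong_AE)
    show "awgn_common lam \<in> borel_measurable lborel" "(\<lambda>z. h z + h (- z)) \<in> borel_measurable lborel"
      using integrable_awgn_common hI hI' by auto
    have "AE z in lborel. z \<noteq> (0::real)" by (rule AE_lborel_singleton)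
    then show "AE z in lborel. awgn_common lam z = h z + h (- z)"
      by eventually_elim (auto simp: awgn_common_eq[OF assms] h_def indicator_def)
  qed
  then show ?thesis using hI hI' Q Q' by simp
qed

lemma integral_mean_awgn_excess:
  "(\<integral>z. (awgn_excess lam False z + awgn_excess lam True z) / 2 \<partial>lborel)
    = 1 - (\<integral>z. awgn_common lam z \<partial>lborel)"
  using integrable_awgn_g integrable_awgn_common by (simp add: awgn_excess_def integral_awgn_g)

lemma integral_awgn_common_le_1: "(\<integral>z. awgn_common lam z \<partial>lborel) \<le> 1"
proof -
  have "0 \<le> (\<integral>z. (awgn_excess lam False z + awgn_excess lam True z) / 2 \<partial>lborel)"
    by (rule Bochner_Integration.integral_nonneg) (simp add: awgn_excess_nonneg)
  then show ?thesis by (simp only: integral_mean_awgn_excess)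
qed

section \<open>The output density as a mixture over revealed sets\<close>

lemma awgn_dens_pos: "awgn_dens lam n x z > 0"
  unfolding awgn_dens_def by (rule prod_pos) (simp add: awgn_g_pos)

lemma degraded_dens_nonneg: "degraded_dens lam n S x z \<ge> 0"
  unfolding degraded_dens_def by (rule prod_nonneg) (simp add: awgn_excess_nonneg awgn_common_nonneg)

lemma degraded_out_dens_nonneg: "degraded_out_dens lam n S z \<ge> 0"
  unfolding degraded_out_dens_def
  by (rule prod_nonneg) (simp add: awgn_excess_nonneg awgn_common_nonneg)

text \<open>Expanding the product of excess plus common part; \<open>S\<close> records the factors
  from which the excess was taken.\<close>

lemma awgn_dens_decomposition:
  "awgn_dens lam n x z = (\<Sum>S\<in>Pow {..<n}. degraded_dens lam n S x z)"
proof -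
  have "awgn_dens lam n x z = (\<Prod>i<n. awgn_excess lam (x i) (z i) + awgn_common lam (z i))"
    by (simp add: awgn_dens_def awgn_excess_def)
  also have "\<dots> = (\<Sum>S\<in>Pow {..<n}. (\<Prod>i\<in>S. awgn_excess lam (x i) (z i))
      * (\<Prod>i\<in>{..<n} - S. awgn_common lam (z i)))"
    by (rule prod_add) simp
  also have "\<dots> = (\<Sum>S\<in>Pow {..<n}. degraded_dens lam n S x z)"
  proof (rule sum.cong)
    fix S assume "S \<in> Pow {..<n}"
    then have S: "{..<n} \<inter> S = S" "{..<n} \<inter> - S = {..<n} - S" by auto
    have "degraded_dens lam n S x z = (\<Prod>i\<in>{..<n} \<inter> {i. i \<in> S}. awgn_excess lam (x i) (z i))
      * (\<Prod>i\<in>{..<n} \<inter> - {i. i \<in> S}. awgn_common lam (z i))"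
      unfolding degraded_dens_def by (rule prod.If_cases) simp
    then show "(\<Prod>i\<in>S. awgn_excess lam (x i) (z i)) * (\<Prod>i\<in>{..<n} - S. awgn_common lam (z i))
      = degraded_dens lam n S x z" by (simp add: S)
  qed simp
  finally show ?thesis .
qed

lemma sum_degraded_dens:
  "(\<Sum>x\<in>bword n. degraded_dens lam n S x z) = 2 ^ n * degraded_out_dens lam n S z"
proof -
  have "(\<Sum>x\<in>bword n. degraded_dens lam n S x z)
      = (\<Prod>i<n. \<Sum>b\<in>UNIV. if i \<in> S then awgn_excess lam b (z i) else awgn_common lam (z i))"
    unfolding degraded_dens_def bword_def by (subst prod_sum_PiE) auto
  also have "\<dots> = (\<Prod>i<n. 2 * (if i \<in> S
      then (awgn_excess lam False (z i) + awgn_excess lam True (z i)) / 2 else awgn_common lam (z i)))"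
    by (rule prod.cong) (auto simp: UNIV_bool)
  also have "\<dots> = 2 ^ n * degraded_out_dens lam n S z"
    unfolding degraded_out_dens_def prod.distrib by simp
  finally show ?thesis .
qed

text \<open>The two excess densities have disjoint supports, so given the output only the inputs that
  agree with one word on \<open>S\<close> contribute.\<close>

lemma sum_degraded_dens_coset:
  assumes C: "linear_code n C" and S: "S \<subseteq> {..<n}"
    and w: "w \<in> nested_cosets n (bword n) (dual_code n C)"
  shows "(\<Sum>x\<in>w. degraded_dens lam n S x z) * (real (card C) / card (shortened n C S))
    \<le> 2 ^ n * degraded_out_dens lam n S z"
proof -
  define b where "b i \<longleftrightarrow> awgn_g lam (bpsk False) (z i) < awgn_g lam (bpsk True) (z i)" for i
  define h where "h = degraded_dens lam n S b z"
  have T: "degraded_dens lam n S x z = (if \<forall>i\<in>S. x i = b i then h else 0)" for x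
  proof (cases "\<forall>i\<in>S. x i = b i")
    case True
    then have "degraded_dens lam n S x z = h"
      unfolding h_def degraded_dens_def by (intro prod.cong) auto
    then show ?thesis using True by simp
  next
    case False
    then obtain i where i: "i \<in> S" "x i \<noteq> b i" by blast
    then have "awgn_excess lam (x i) (z i) = 0" by (intro awgn_excess_eq_0) (simp add: b_def)
    then have "degraded_dens lam n S x z = 0"
      unfolding degraded_dens_def using i S by (intro prod_zero) (auto intro!: bexI[of _ i])
    then show ?thesis using False by auto
  qed
  have sumT: "(\<Sum>x\<in>X. degraded_dens lam n S x z) = h * card {x \<in> X. \<forall>i\<in>S. x i = b i}"
    if "finite X" for X
    unfolding T using that by (simp add: sum.If_cases Int_def)
  have fw: "finite w" using nested_cosets_partition(3)[OF linear_dual_code w] by simp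
  have Cp: "real (card C) > 0" "real (card (shortened n C S)) > 0"
    using linear_codeD(5)[OF C] linear_codeD(5)[OF linear_shortened[OF C]] by auto
  \<comment> \<open>By duality the agreeing words of one coset are at most a fraction
    \<open>card (shortened n C S) / card C\<close> of all agreeing words, and all of these have the
    same density \<open>h\<close>.\<close>
  have "real (card C) * real (card {x \<in> w. \<forall>i\<in>S. x i = b i})
      \<le> real (card C) * real (card (dual_code n C \<inter> zero_on n S))"
    using card_coset_agreeing[OF linear_dual_code w S] by (intro mult_left_mono) auto
  also have "\<dots> = real (card {x \<in> bword n. \<forall>i\<in>S. x i = b i}) * real (card (shortened n C S))"
    using card_dual_zero_on[OF C S] unfolding card_fixed_positions[OF S] of_nat_mult[symmetric]
    by simp
  finally have "real (card {x \<in> w. \<forall>i\<in>S. x i = b i}) * (real (card C) / card (shortened n C S))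
      \<le> real (card {x \<in> bword n. \<forall>i\<in>S. x i = b i})"
    using Cp by (simp add: field_simps)
  then have "h * (real (card {x \<in> w. \<forall>i\<in>S. x i = b i}) * (real (card C) / card (shortened n C S)))
      \<le> h * real (card {x \<in> bword n. \<forall>i\<in>S. x i = b i})"
    by (rule mult_left_mono) (simp add: h_def degraded_dens_nonneg)
  then show ?thesis
    unfolding sum_degraded_dens[symmetric] sumT[OF fw] sumT[OF finite_bword] by (simp only: mult.assoc)
qed

text \<open>The density is a product over positions, so its integral factors. Integrating out
  \<open>z\<close> shows that positions are revealed independently with probability
  \<open>p\<close>.\<close>

lemma degraded_out_dens_integral:
  fixes lam :: real
  defines "p \<equiv> 1 - (\<integral>z. awgn_common lam z \<partial>lborel)"
  shows "integrable (PiM {..<n} (\<lambda>_. lborel)) (degraded_out_dens lam n S)"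
    and "(\<integral>z. degraded_out_dens lam n S z \<partial>PiM {..<n} (\<lambda>_. lborel)) = random_subset_weight p {..<n} S"
proof -
  interpret product_sigma_finite "\<lambda>_. lborel :: real measure" by standard
  define f where "f i z = (if i \<in> S then (awgn_excess lam False z + awgn_excess lam True z) / 2
    else awgn_common lam z)" for i :: nat and z
  have fi: "integrable lborel (f i)" for i
    using integrable_awgn_g integrable_awgn_common by (cases "i \<in> S") (auto simp: f_def[abs_def] awgn_excess_def)
  have eq: "degraded_out_dens lam n S = (\<lambda>z. \<Prod>i<n. f i (z i))"
    by (simp add: degraded_out_dens_def[abs_def] f_def)
  show "integrable (PiM {..<n} (\<lambda>_. lborel)) (degraded_out_dens lam n S)"
    unfolding eq by (rule product_integrable_prod) (simp_all add: fi)
  have "(\<integral>z. degraded_out_dens lam n S z \<partial>PiM {..<n} (\<lambda>_. lborel)) = (\<Prod>i<n. integral\<^sup>L lborel (f i))"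
    unfolding eq by (rule product_integral_prod) (simp_all add: fi)
  also have "\<dots> = random_subset_weight p {..<n} S"
    unfolding random_subset_weight_def
  proof (rule prod.cong)
    show "integral\<^sup>L lborel (f i) = (if i \<in> S then p else 1 - p)" for i
      using integral_mean_awgn_excess[of lam]
      by (cases "i \<in> S") (simp_all only: f_def[abs_def] p_def if_True if_False diff_diff_eq2 add_diff_cancel_left')
  qed simp
  finally show "(\<integral>z. degraded_out_dens lam n S z \<partial>PiM {..<n} (\<lambda>_. lborel)) = random_subset_weight p {..<n} S" .
qed

text \<open>The integrand \<open>\<phi>\<close> is squeezed, at every output \<open>z\<close>,
  between \<open>lo\<close> and \<open>up\<close> by the two entropy inequalities, with the revealed
  set as side information; then all three are integrated.\<close>

lemma eve_equivocation_bounds: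
  fixes lam :: real
  assumes C: "linear_code n C"
  defines "p \<equiv> 1 - (\<integral>z. awgn_common lam z \<partial>lborel)"
    and "Ws \<equiv> nested_cosets n (bword n) (dual_code n C)"
  shows "log 2 (card C) - random_subset_mean p {..<n} (\<lambda>S. log 2 (card (shortened n C S)))
      \<le> eve_equivocation lam n Ws" (is ?lower)
    and "eve_equivocation lam n Ws \<le> log 2 (card C)" (is ?upper)
proof -
  let ?P = "PiM {..<n} (\<lambda>_. lborel :: real measure)"
  let ?A = "degraded_out_dens lam n"
  define M where "M S = real (card C) / card (shortened n C S)" for S
  define f where "f w z = 1 / real (card Ws) * msg_dens lam n w z" for w z
  define \<phi> where "\<phi> z = (\<Sum>w\<in>Ws. f w z * (- log 2 (f w z / (\<Sum>v\<in>Ws. f v z))))" for z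
  define lo where "lo z = (\<Sum>S\<in>Pow {..<n}. ?A S z * log 2 (M S))" for z
  define up where "up z = (\<Sum>S\<in>Pow {..<n}. ?A S z) * log 2 (card C)" for z
  note D = linear_dual_code[of n C]
  note part = nested_cosets_partition[OF D, folded Ws_def]
  have cardWs: "card Ws = card C" using card_nested_cosets_dual[OF C] by (simp add: Ws_def)
  have cp: "card C > 0" using linear_codeD(5)[OF C] .
  have sp: "card (shortened n C S) > 0" for S using linear_codeD(5)[OF linear_shortened[OF C]] .
  have Mp: "M S > 0" for S using cp sp[of S] by (simp add: M_def)
  \<comment> \<open>All cosets have the same size, so a uniform message followed by a uniform member
    of its coset is a uniform word.\<close>
  have f: "f w z = (\<Sum>x\<in>w. awgn_dens lam n x z) / 2 ^ n" if w: "w \<in> Ws" for w z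
  proof -
    have "card Ws * card w = 2 ^ n" using card_nested_cosets[OF D] part(3)[OF w] by (simp add: Ws_def)
    then have "real (card Ws) * real (card w) = 2 ^ n"
      by (metis of_nat_mult of_nat_numeral of_nat_power)
    then show ?thesis by (simp add: f_def msg_dens_def)
  qed
  have fp: "f w z > 0" if w: "w \<in> Ws" for w z
  proof -
    have "w \<noteq> {}" using part(3)[OF w] linear_codeD(5)[OF D] by auto
    then show ?thesis
      unfolding f[OF w] using part(3)[OF w] by (intro divide_pos_pos sum_pos) (auto simp: awgn_dens_pos)
  qed
  define a where "a w S z = (\<Sum>x\<in>w. degraded_dens lam n S x z) / 2 ^ n" for w S z
  have A: "?A S z = (\<Sum>w\<in>Ws. a w S z)" for S z
  proof -
    have "(\<Sum>w\<in>Ws. a w S z) = (\<Sum>x\<in>bword n. degraded_dens lam n S x z) / 2 ^ n"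
      unfolding a_def sum_divide_distrib[symmetric] Ws_def sum_over_cosets[OF D] ..
    then show ?thesis by (simp add: sum_degraded_dens)
  qed
  have fa: "f w z = (\<Sum>S\<in>Pow {..<n}. a w S z)" if "w \<in> Ws" for w z
    unfolding f[OF that] a_def sum_divide_distrib[symmetric] awgn_dens_decomposition
    by (subst sum.swap) simp
  have fsum: "(\<Sum>w\<in>Ws. f w z) = (\<Sum>S\<in>Pow {..<n}. ?A S z)" for z
    by (simp add: fa A sum.swap[of _ Ws])
  have lo_le: "lo z \<le> \<phi> z" for z
    unfolding lo_def \<phi>_def
  proof (rule log_sum_lower[where a = "\<lambda>w S. a w S z"])
    show "finite Ws" "finite (Pow {..<n})" using part(2) by auto
    show "a w S z * M S \<le> ?A S z" if "w \<in> Ws" "S \<in> Pow {..<n}" for w S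
    proof -
      have "(\<Sum>x\<in>w. degraded_dens lam n S x z) * M S \<le> 2 ^ n * ?A S z"
        unfolding M_def using that by (intro sum_degraded_dens_coset[OF C]) (auto simp: Ws_def)
      then have "(\<Sum>x\<in>w. degraded_dens lam n S x z) * M S / 2 ^ n \<le> ?A S z"
        by (simp add: pos_divide_le_eq mult.commute)
      then show ?thesis by (simp add: a_def)
    qed
  qed (assumption | rule fp fa A Mp | simp add: a_def sum_nonneg degraded_dens_nonneg)+
  have le_up: "\<phi> z \<le> up z" for z
    using entropy_sum_upper[OF part(2), of "\<lambda>w. f w z"] fp
    unfolding up_def \<phi>_def fsum[symmetric] cardWs by simp
  \<comment> \<open>This makes \<open>lo\<close> nonnegative, so that \<open>up\<close> dominates
    \<open>\<phi>\<close> in absolute value and yields its integrability.\<close>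
  have M1: "M S \<ge> 1" for S
  proof -
    have "card (shortened n C S) \<le> card C"
      by (rule card_mono[OF linear_codeD(4)[OF C]]) (auto simp: shortened_def)
    then show ?thesis using sp[of S] by (simp add: M_def)
  qed
  have lo0: "0 \<le> lo z" for z
    unfolding lo_def
    by (intro sum_nonneg mult_nonneg_nonneg degraded_out_dens_nonneg zero_le_log_cancel_iff[THEN iffD2])
      (simp_all add: M1 Mp)
  have AI: "integrable ?P (?A S)" for S by (rule degraded_out_dens_integral(1))
  have loI: "integrable ?P lo" unfolding lo_def[abs_def] using AI by simp
  have upI: "integrable ?P up" unfolding up_def[abs_def] using AI by simp
  have meas: "\<phi> \<in> borel_measurable ?P"
    unfolding \<phi>_def[abs_def] f_def msg_dens_def awgn_dens_def by measurable
  have \<phi>I: "integrable ?P \<phi>"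
  proof (rule Bochner_Integration.integrable_bound[OF upI meas])
    show "AE z in ?P. norm (\<phi> z) \<le> norm (up z)"
      using lo0 lo_le le_up by (intro AE_I2) (smt (verit) real_norm_def)
  qed
  have eve: "eve_equivocation lam n Ws = integral\<^sup>L ?P \<phi>"
    by (simp add: eve_equivocation_def Let_def \<phi>_def[abs_def] f_def)
  note AV = degraded_out_dens_integral(2)[of n lam, folded p_def]
  have "integral\<^sup>L ?P lo = (\<Sum>S\<in>Pow {..<n}. random_subset_weight p {..<n} S * log 2 (M S))"
    unfolding lo_def[abs_def] using AI by (simp add: AV)
  also have "\<dots> = random_subset_mean p {..<n} (\<lambda>S. log 2 (card C) - log 2 (card (shortened n C S)))"
    using cp sp by (simp add: random_subset_mean_def M_def log_divide)
  also have "\<dots> = log 2 (card C) - random_subset_mean p {..<n} (\<lambda>S. log 2 (card (shortened n C S)))"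
    by (simp add: random_subset_mean_diff random_subset_mean_const)
  finally show ?lower
    unfolding eve using integral_mono[OF loI \<phi>I lo_le] by simp
  have "integral\<^sup>L ?P up = random_subset_mean p {..<n} (\<lambda>_. 1) * log 2 (card C)"
    unfolding up_def[abs_def] random_subset_mean_def using AI by (simp add: AV)
  then have "integral\<^sup>L ?P up = log 2 (card C)" by (simp add: random_subset_mean_const)
  then show ?upper
    unfolding eve using integral_mono[OF \<phi>I upI le_up] by simp
qed

section \<open>Passage to the limit along the code sequence\<close>

theorem theorem2:
  fixes lam Rc \<delta>s :: real
    and len :: "nat \<Rightarrow> nat"
    and C :: "nat \<Rightarrow> (nat \<Rightarrow> bool) set"
  assumes "lam > 0"
    and "strict_mono len"
    and "\<forall>m. linear_code (len m) (C m)"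
    and "\<forall>m. log 2 (real (card (C m))) = Rc * real (len m)"
    and "good_code_seq len C Rc"
    and "\<delta>s = erasure_threshold len C"
    and "Qfun (sqrt (2 * lam)) \<ge> (1 - \<delta>s) / 2"
  shows "(\<forall>m. log 2 (real (card (nested_cosets (len m) (bword (len m)) (dual_code (len m) (C m)))))
               = Rc * real (len m))
       \<and> (\<lambda>m. legit_error (len m) (bword (len m)) (dual_code (len m) (C m))) \<longlonglongrightarrow> 0
       \<and> convergent (\<lambda>m. eve_equivocation lam (len m)
                (nested_cosets (len m) (bword (len m)) (dual_code (len m) (C m))) / real (len m))
       \<and> Rc \<le> lim (\<lambda>m. eve_equivocation lam (len m)
                (nested_cosets (len m) (bword (len m)) (dual_code (len m) (C m))) / real (len m))"
proof -
  note lin = assms(3)[rule_format]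
  define p where "p = 1 - (\<integral>z. awgn_common lam z \<partial>lborel)"
  define X where "X m = eve_equivocation lam (len m)
    (nested_cosets (len m) (bword (len m)) (dual_code (len m) (C m))) / real (len m)" for m
  let ?err = "\<lambda>\<delta> m. bec_ml_error \<delta> (len m) (C m)"
  let ?\<Delta> = "{\<delta> \<in> {0..1}. ?err \<delta> \<longlonglongrightarrow> 0}"
  have p: "0 \<le> p" "p \<le> 1"
    unfolding p_def using integral_awgn_common_le_1[of lam]
      Bochner_Integration.integral_nonneg[of lborel "awgn_common lam"] awgn_common_nonneg by auto
  \<comment> \<open>The hypothesis on \<open>Qfun\<close> says exactly that the probability of a
    revealed position does not exceed the threshold.\<close>
  have p\<delta>: "p \<le> \<delta>s" unfolding p_def integral_awgn_common[OF assms(1)] using assms(7) by simp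
  have ne: "?\<Delta> \<noteq> {}" using assms(5) by (fastforce simp: good_code_seq_def)
  \<comment> \<open>Index 0 is excluded since \<open>len 0\<close> may be 0, whereas strict
    monotonicity gives \<open>m \<le> len m\<close>.\<close>
  have lenpos: "real (len m) > 0" if "m \<ge> 1" for m
    using that strict_mono_imp_increasing[OF assms(2), of m] by simp
  have upper: "X m \<le> Rc" if "m \<ge> 1" for m
    using eve_equivocation_bounds(2)[OF lin, of lam m] lenpos[OF that] assms(4)
    by (simp add: X_def divide_le_eq)
  \<comment> \<open>The slack \<open>\<eta>\<close> allows \<open>p\<close> to exceed the erasure
    rate \<open>\<delta>\<close> at which the error is controlled.\<close>
  have lower: "Rc - 2 * ?err \<delta> m - \<eta> \<le> X m"
    if "m \<ge> 1" "\<delta> \<in> {0..1}" "p - \<delta> \<le> \<eta>" "0 \<le> \<eta>" for m \<delta> \<eta>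
  proof -
    let ?n = "real (len m)" and ?F = "\<lambda>S. log 2 (card (shortened (len m) (C m) S))"
    have "random_subset_mean p {..<len m} ?F \<le> random_subset_mean \<delta> {..<len m} ?F + ?n * \<eta>"
      using that p by (intro mean_log_card_shortened_lipschitz lin) auto
    also have "\<dots> \<le> 2 * ?n * ?err \<delta> m + ?n * \<eta>"
      using mean_log_card_shortened_le[OF lin] that by simp
    finally have "?n * (Rc - 2 * ?err \<delta> m - \<eta>) \<le> eve_equivocation lam (len m)
        (nested_cosets (len m) (bword (len m)) (dual_code (len m) (C m)))"
      using eve_equivocation_bounds(1)[OF lin, of m lam, folded p_def] assms(4)
      by (simp add: algebra_simps)
    then show ?thesis
      unfolding X_def using lenpos[OF that(1)] by (simp add: le_divide_eq mult.commute)
  qed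
  have lim: "X \<longlonglongrightarrow> Rc"
  proof (rule LIMSEQ_I)
    fix e :: real assume e: "e > 0"
    \<comment> \<open>The supremum need not be attained, so a rate within \<open>e / 2\<close> below
      it is used with \<open>\<eta> = e / 2\<close>; twice an error below \<open>e / 4\<close> uses
      up the other half of \<open>e\<close>.\<close>
    have "\<delta>s - e / 2 < Sup ?\<Delta>" using e assms(6) by (simp add: erasure_threshold_def)
    then obtain \<delta> where \<delta>: "\<delta> \<in> ?\<Delta>" "\<delta>s - e / 2 < \<delta>" using less_cSupD[OF ne] by blast
    then obtain N where N: "\<And>m. m \<ge> N \<Longrightarrow> norm (?err \<delta> m - 0) < e / 4"
      using LIMSEQ_D[of "?err \<delta>" 0 "e / 4"] e by auto
    have "norm (X m - Rc) < e" if m: "m \<ge> max N 1" for m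
    proof -
      have "Rc - 2 * ?err \<delta> m - e / 2 \<le> X m" using m \<delta> p\<delta> e by (intro lower) auto
      moreover have "?err \<delta> m < e / 4" using N[of m] m by auto
      ultimately show ?thesis using upper[of m] m e by (simp add: abs_less_iff)
    qed
    then show "\<exists>N. \<forall>m\<ge>N. norm (X m - Rc) < e" by blast
  qed
  show ?thesis
    unfolding X_def[symmetric] card_nested_cosets_dual[OF lin] legit_error_eq_0[OF linear_dual_code]
    using assms(4) lim limI[OF lim] by (auto simp: convergent_def)
qed

end
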